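(* Let $T$ be a contraction on a complex Hilbert space $\mathcal{H}$. Then there exists a maximum (with respect to inclusion) closed subspace $\mathcal{M}\subset\mathcal{H}$ which is invariant for $T$ and on which $T$ is a partial isometry. More precisely, one has $$\mathcal{N}(T)\subset \mathcal{M}\subset \mathcal{N}(T)\oplus\mathcal{N}(I-T^*T),$$ and $T$ has the block matrix form $$T=\begin{pmatrix} W & R\\ 0 & Q\end{pmatrix}$$ on $\mathcal{H}=\mathcal{M}\oplus\mathcal{M}^{\perp}$, where $W$ is a partial isometry on $\mathcal{M}$, $R\in\mathcal{B}(\mathcal{M}^{\perp},\mathcal{M})$ is a contraction with $W^*R=0$, and $Q$ is a contraction on $\mathcal{M}^{\perp}$ such that $\mathcal{N}(I-Q^*Q)\subset\mathcal{N}(I-T^*T)$. Moreover, one has $$\mathcal{N}(T)\oplus\mathcal{N}(I-T^*T)=\mathcal{M}\oplus\mathcal{N}(I-Q^*Q)$$ if and only if $\mathcal{N}(I-T^*T)\cap\mathcal{M}^{\perp}\subset\mathcal{N}(R)$.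
   Context: $\mathcal{B}(\mathcal{H},\mathcal{K})$ is the space of bounded linear operators between the complex Hilbert spaces $\mathcal{H},\mathcal{K}$, and $\mathcal{B}(\mathcal{H})=\mathcal{B}(\mathcal{H},\mathcal{H})$. $\mathcal{N}(\cdot)$ denotes the null-space and $I$ the identity operator on the relevant space. A contraction is an operator of norm at most $1$. An operator $T$ is a partial isometry if $T^*T$ is an orthogonal projection. A closed subspace $\mathcal{G}$ is invariant for $T$ if $T\mathcal{G}\subset\mathcal{G}$; "$T$ is a partial isometry on the invariant subspace $\mathcal{G}$" means that the restriction $T|_{\mathcal{G}}\in\mathcal{B}(\mathcal{G})$ is a partial isometry. "Maximum" means that $\mathcal{M}$ contains every other closed subspace with the stated property. In the block matrix, $W=T|_{\mathcal{M}}$, and $R$, $Q$ are the compressions of $T|_{\mathcal{M}^\perp}$ to $\mathcal{M}$, $\mathcal{M}^\perp$ respectively; $\mathcal{N}(I-Q^*Q)$ is a subspace of $\mathcal{M}^\perp$, regarded as a subspace of $\mathcal{H}$. *)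

theory Defs
  imports "HOL-Analysis.Analysis"
begin

text \<open>
  A complex inner product space is a real inner product space together with a complex scalar
  multiplication extending the real one and a complex inner product whose real part is the real
  inner product. Hence the norm is \<open>norm x = sqrt (Re (cinner x x))\<close>, and norm, topology and
  completeness are those of the library. The inner product is linear in its first argument.
\<close>

class complex_inner = real_inner +
  fixes scaleC :: "complex \<Rightarrow> 'a \<Rightarrow> 'a" (infixr "*\<^sub>C" 75)
    and cinner :: "'a \<Rightarrow> 'a \<Rightarrow> complex"
  assumes scaleC_add_right: "c *\<^sub>C (x + y) = c *\<^sub>C x + c *\<^sub>C y"
    and scaleC_add_left: "(c + d) *\<^sub>C x = c *\<^sub>C x + d *\<^sub>C x"
    and scaleC_scaleC: "c *\<^sub>C d *\<^sub>C x = (c * d) *\<^sub>C x"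
    and scaleC_of_real: "complex_of_real r *\<^sub>C x = r *\<^sub>R x"
    and cinner_commute: "cinner x y = cnj (cinner y x)"
    and cinner_add_left: "cinner (x + y) z = cinner x z + cinner y z"
    and cinner_scaleC_left: "cinner (c *\<^sub>C x) y = c * cinner x y"
    and Re_cinner: "Re (cinner x y) = inner x y"

class chilbert_space = complex_inner + complete_space

lemma scaleC_one: "1 *\<^sub>C x = (x :: 'a::complex_inner)"
  using scaleC_of_real[of 1 x] by simp

interpretation complex_vector: vector_space "scaleC :: complex \<Rightarrow> 'a \<Rightarrow> 'a::complex_inner"
  by standard (simp_all add: scaleC_add_right scaleC_add_left scaleC_scaleC scaleC_one)

abbreviation csubspace :: "'a::complex_inner set \<Rightarrow> bool"
  where "csubspace \<equiv> module.subspace scaleC"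

instantiation complex :: chilbert_space
begin

definition "scaleC (c::complex) (x::complex) = c * x"

definition "cinner (x::complex) (y::complex) = x * cnj y"

instance
  by standard
    (simp_all add: scaleC_complex_def cinner_complex_def inner_complex_def algebra_simps
      scaleR_conv_of_real)

end

definition closed_csubspace :: "'a::complex_inner set \<Rightarrow> bool"
  where "closed_csubspace G \<longleftrightarrow> csubspace G \<and> closed G"

definition ocompl :: "'a::complex_inner set \<Rightarrow> 'a set"
  where "ocompl G = {x. \<forall>y\<in>G. cinner x y = 0}"

definition orthogonal_sets :: "'a::complex_inner set \<Rightarrow> 'a set \<Rightarrow> bool"
  where "orthogonal_sets G K \<longleftrightarrow> (\<forall>x\<in>G. \<forall>y\<in>K. cinner x y = 0)"

text \<open>
  \<open>G \<^bold>\<oplus> K\<close> is the algebraic sum; orthogonality of the summands is stated separately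
  where it is not immediate.
\<close>

definition subspace_sum :: "'a::complex_inner set \<Rightarrow> 'a set \<Rightarrow> 'a set" (infixl "\<^bold>\<oplus>" 65)
  where "G \<^bold>\<oplus> K = {x + y | x y. x \<in> G \<and> y \<in> K}"

definition proj_on :: "'a::complex_inner set \<Rightarrow> 'a \<Rightarrow> 'a"
  where "proj_on G x = (THE p. p \<in> G \<and> x - p \<in> ocompl G)"

text \<open>
  An operator from a closed subspace \<open>G\<close> to a closed subspace \<open>K\<close> is represented by a function
  on the ambient spaces of which only the values on \<open>G\<close> are relevant; all notions below carry
  their domain, and where needed their codomain, as arguments. Operators on the whole space
  have \<open>G = K = UNIV\<close>.
\<close>

definition bounded_op_on ::
    "'a::complex_inner set \<Rightarrow> 'b::complex_inner set \<Rightarrow> ('a \<Rightarrow> 'b) \<Rightarrow> bool"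
  where "bounded_op_on G K A \<longleftrightarrow>
    (\<forall>x\<in>G. A x \<in> K) \<and>
    (\<forall>x\<in>G. \<forall>y\<in>G. A (x + y) = A x + A y) \<and>
    (\<forall>c. \<forall>x\<in>G. A (c *\<^sub>C x) = c *\<^sub>C A x) \<and>
    (\<exists>B. \<forall>x\<in>G. norm (A x) \<le> B * norm x)"

text \<open>This is \<^const>\<open>onorm\<close> with the supremum restricted to \<open>G\<close>.\<close>

definition onorm_on :: "'a::complex_inner set \<Rightarrow> ('a \<Rightarrow> 'b::complex_inner) \<Rightarrow> real"
  where "onorm_on G A = (SUP x\<in>G. norm (A x) / norm x)"

definition contraction_on ::
    "'a::complex_inner set \<Rightarrow> 'b::complex_inner set \<Rightarrow> ('a \<Rightarrow> 'b) \<Rightarrow> bool"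
  where "contraction_on G K A \<longleftrightarrow> bounded_op_on G K A \<and> onorm_on G A \<le> 1"

definition adj_on ::
    "'a::complex_inner set \<Rightarrow> 'b::complex_inner set \<Rightarrow> ('a \<Rightarrow> 'b) \<Rightarrow> 'b \<Rightarrow> 'a"
  where "adj_on G K A =
    (\<lambda>y\<in>K. THE z. z \<in> G \<and> (\<forall>x\<in>G. cinner (A x) y = cinner x z))"

definition null_space :: "'a::complex_inner set \<Rightarrow> ('a \<Rightarrow> 'b::complex_inner) \<Rightarrow> 'a set"
  where "null_space G A = {x \<in> G. A x = 0}"

definition orth_projection_on :: "'a::complex_inner set \<Rightarrow> ('a \<Rightarrow> 'a) \<Rightarrow> bool"
  where "orth_projection_on G P \<longleftrightarrow>
    (\<exists>S. closed_csubspace S \<and> S \<subseteq> G \<and> (\<forall>x\<in>G. P x = proj_on S x))"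

definition partial_isometry_on ::
    "'a::complex_inner set \<Rightarrow> 'b::complex_inner set \<Rightarrow> ('a \<Rightarrow> 'b) \<Rightarrow> bool"
  where "partial_isometry_on G K A \<longleftrightarrow>
    bounded_op_on G K A \<and> orth_projection_on G (\<lambda>x. adj_on G K A (A x))"

definition invariant_for :: "('a::complex_inner \<Rightarrow> 'a) \<Rightarrow> 'a set \<Rightarrow> bool"
  where "invariant_for T G \<longleftrightarrow> T ` G \<subseteq> G"

definition compression :: "'a::complex_inner set \<Rightarrow> 'a set \<Rightarrow> ('a \<Rightarrow> 'a) \<Rightarrow> 'a \<Rightarrow> 'a"
  where "compression G K T = (\<lambda>x\<in>G. proj_on K (T x))"

text \<open>\<open>T\<close> has the block matrix \<open>(A, B; C, D)\<close> on the orthogonal sum of \<open>M\<close> and \<open>ocompl M\<close>.\<close>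

definition has_block_matrix ::
    "('a::complex_inner \<Rightarrow> 'a) \<Rightarrow> 'a set \<Rightarrow>
      ('a \<Rightarrow> 'a) \<Rightarrow> ('a \<Rightarrow> 'a) \<Rightarrow> ('a \<Rightarrow> 'a) \<Rightarrow> ('a \<Rightarrow> 'a) \<Rightarrow> bool"
  where "has_block_matrix T M A B C D \<longleftrightarrow>
    M \<^bold>\<oplus> ocompl M = UNIV \<and>
    bounded_op_on M M A \<and> bounded_op_on (ocompl M) M B \<and>
    bounded_op_on M (ocompl M) C \<and> bounded_op_on (ocompl M) (ocompl M) D \<and>
    (\<forall>x\<in>M. \<forall>y\<in>ocompl M. T (x + y) = (A x + B y) + (C x + D y))"

definition pi_invariant :: "('a::complex_inner \<Rightarrow> 'a) \<Rightarrow> 'a set \<Rightarrow> bool"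
  where "pi_invariant T G \<longleftrightarrow>
    closed_csubspace G \<and> invariant_for T G \<and> partial_isometry_on G G (restrict T G)"

definition defect_null :: "'a::complex_inner set \<Rightarrow> 'b::complex_inner set \<Rightarrow> ('a \<Rightarrow> 'b) \<Rightarrow> 'a set"
  where "defect_null G K A = null_space G (\<lambda>x. x - adj_on G K A (A x))"

end

theory Submission
  imports Defs
begin

text \<open>
  Let \<open>N\<close> be the kernel of \<open>T\<close> and \<open>D\<close> the kernel of \<open>I - T\<^sup>*T\<close>, which for a contraction is the
  set of vectors whose norm \<open>T\<close> preserves. A contraction is a partial isometry iff its domain is
  the orthogonal sum of these two kernels, so an invariant subspace on which \<open>T\<close> is a partial
  isometry lies in \<open>N \<oplus> D\<close>; the maximum one consists of the vectors whose whole orbit stays in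
  \<open>N \<oplus> D\<close>. On the orthogonal complement of this \<open>M\<close>, a vector \<open>x\<close> with \<open>\<parallel>Q x\<parallel> = \<parallel>x\<parallel>\<close> is exactly
  a vector of \<open>D\<close> with \<open>R x = 0\<close>, because \<open>\<parallel>T x\<parallel>\<^sup>2 = \<parallel>R x\<parallel>\<^sup>2 + \<parallel>Q x\<parallel>\<^sup>2\<close>; the final equivalence
  follows since the projection of \<open>D\<close> to \<open>M\<close> stays in \<open>D\<close>.
\<close>

section \<open>Complex inner product\<close>

lemma cinner_zero_left [simp]: "cinner 0 y = 0"
  using cinner_add_left[of 0 0 y] by simp

lemma cinner_zero_right [simp]: "cinner x 0 = 0"
  using cinner_commute[of x 0] by simp

lemma cinner_add_right: "cinner x (y + z) = cinner x y + cinner x z"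
  by (metis cinner_commute cinner_add_left complex_cnj_add)

lemma cinner_minus_left [simp]: "cinner (- x) y = - cinner x y"
  using cinner_add_left[of x "- x" y] by (simp add: eq_neg_iff_add_eq_0 add.commute)

lemma cinner_minus_right [simp]: "cinner x (- y) = - cinner x y"
  using cinner_add_right[of x y "- y"] by (simp add: eq_neg_iff_add_eq_0 add.commute)

lemma cinner_diff_left: "cinner (x - y) z = cinner x z - cinner y z"
  using cinner_add_left[of x "- y" z] by simp

lemma cinner_diff_right: "cinner x (y - z) = cinner x y - cinner x z"
  using cinner_add_right[of x y "- z"] by simp

lemma cinner_scaleC_right: "cinner x (c *\<^sub>C y) = cnj c * cinner x y"
  by (metis cinner_commute cinner_scaleC_left complex_cnj_mult)

lemma cinner_eq_0_commute: "cinner x y = 0 \<longleftrightarrow> cinner y x = 0"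
  by (metis cinner_commute complex_cnj_zero)

lemma cinner_self: "cinner x x = complex_of_real ((norm x)\<^sup>2)"
proof -
  have "Im (cinner x x) = 0"
    using cinner_commute[of x x] by (metis Reals_cnj_iff complex_is_Real_iff)
  then show ?thesis
    by (simp add: complex_eq_iff Re_cinner power2_norm_eq_inner)
qed

lemma cinner_self_eq_0 [simp]: "cinner x x = 0 \<longleftrightarrow> x = 0"
  by (simp add: cinner_self)

text \<open>Multiplying the second argument by \<open>\<i>\<close> multiplies the inner product by
  \<open>- \<i>\<close>, which moves the imaginary part into the real one. Continuity and
  orthogonality thereby reduce to the real inner product.\<close>

lemma cinner_conv_inner: "cinner x y = Complex (inner x y) (inner x (\<i> *\<^sub>C y))"
  by (simp add: complex_eq_iff Re_cinner[symmetric] cinner_scaleC_right)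

lemma continuous_on_cinner_left [continuous_intros]:
  "continuous_on S f \<Longrightarrow> continuous_on S (\<lambda>x. cinner (f x) y)"
  unfolding cinner_conv_inner Complex_eq by (intro continuous_intros)

lemma norm_add_square_orthogonal:
  assumes "cinner x y = 0"
  shows "(norm (x + y))\<^sup>2 = (norm x)\<^sup>2 + (norm y)\<^sup>2"
proof -
  have "inner x y = 0"
    using assms by (simp flip: Re_cinner)
  then show ?thesis
    by (simp add: power2_norm_eq_inner inner_add_left inner_add_right inner_commute)
qed

section \<open>Closed subspaces and orthogonal projections\<close>

lemma csubspace_scaleR: "csubspace G \<Longrightarrow> x \<in> G \<Longrightarrow> r *\<^sub>R x \<in> G"
  using complex_vector.subspace_scale[of G x "complex_of_real r"] by (simp add: scaleC_of_real)

lemma csubspace_imp_subspace: "csubspace G \<Longrightarrow> subspace G"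
  by (simp add: subspace_def csubspace_scaleR complex_vector.subspace_0
      complex_vector.subspace_add)

lemma closed_csubspace_UNIV: "closed_csubspace UNIV"
  by (simp add: closed_csubspace_def)

lemma closed_csubspaceD:
  assumes "closed_csubspace G"
  shows "csubspace G" "closed G" "0 \<in> G"
    and "x \<in> G \<Longrightarrow> y \<in> G \<Longrightarrow> x + y \<in> G" "x \<in> G \<Longrightarrow> y \<in> G \<Longrightarrow> x - y \<in> G"
    and "x \<in> G \<Longrightarrow> c *\<^sub>C x \<in> G"
  using assms by (auto simp: closed_csubspace_def complex_vector.subspace_0
      complex_vector.subspace_add complex_vector.subspace_diff complex_vector.subspace_scale)

lemma csubspace_ocompl: "csubspace (ocompl G)"
  by (auto simp: complex_vector.subspace_def ocompl_def cinner_add_left cinner_scaleC_left)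

lemma closed_csubspace_ocompl: "closed_csubspace (ocompl G)"
proof -
  have "ocompl G = (\<Inter>y\<in>G. {x. cinner x y = 0})"
    by (auto simp: ocompl_def)
  moreover have "closed {x. cinner x y = 0}" for y :: 'a
    by (intro closed_Collect_eq continuous_intros)
  ultimately have "closed (ocompl G)"
    by (simp add: closed_INT)
  then show ?thesis
    by (simp add: closed_csubspace_def csubspace_ocompl)
qed

lemma ocomplD: "x \<in> ocompl G \<Longrightarrow> y \<in> G \<Longrightarrow> cinner x y = 0"
  by (simp add: ocompl_def)

lemma ocomplD': "x \<in> ocompl G \<Longrightarrow> y \<in> G \<Longrightarrow> cinner y x = 0"
  using cinner_eq_0_commute ocomplD by blast

lemma ocompl_disjoint: "x \<in> G \<Longrightarrow> x \<in> ocompl G \<Longrightarrow> x = 0"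
  using ocomplD by fastforce

section \<open>Existence of orthogonal projections through closest points\<close>

lemma inner_eq_0_if_closest:
  fixes x p v :: "'a::real_inner"
  assumes "\<And>t. (norm (x - p))\<^sup>2 \<le> (norm (x - (p + t *\<^sub>R v)))\<^sup>2"
  shows "inner (x - p) v = 0"
proof (cases "v = 0")
  case False
  define a where "a = inner (x - p) v"
  \<comment> \<open>This \<open>t\<close> minimizes the quadratic in the next line; there the
    squared distance drops by \<open>a\<^sup>2 / (norm v)\<^sup>2\<close>, which a closest point
    permits only for \<open>a = 0\<close>.\<close>
  define t where "t = a / (norm v)\<^sup>2"
  have "(norm (x - (p + t *\<^sub>R v)))\<^sup>2 = (norm (x - p))\<^sup>2 - 2 * t * a + t\<^sup>2 * (norm v)\<^sup>2"
    unfolding a_def power2_norm_eq_inner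
    by (simp add: inner_simps inner_commute algebra_simps power2_eq_square)
  then have "2 * t * a \<le> t\<^sup>2 * (norm v)\<^sup>2"
    using assms[of t] by simp
  moreover have "t * (norm v)\<^sup>2 = a"
    using False by (simp add: t_def)
  ultimately have "2 * (t * a) \<le> t * a"
    by (metis mult.assoc power2_eq_square)
  then have "a\<^sup>2 / (norm v)\<^sup>2 \<le> 0"
    by (simp add: t_def power2_eq_square)
  then have "a = 0"
    using False by (simp add: divide_le_0_iff)
  then show ?thesis
    by (simp add: a_def)
qed simp

text \<open>By the parallelogram law a minimizing sequence for the distance is Cauchy.\<close>

lemma ex_closest_in_subspace:
  fixes x :: "'a::{real_inner, complete_space}"
  assumes "subspace L" "closed L"
  shows "\<exists>p\<in>L. \<forall>v\<in>L. (norm (x - p))\<^sup>2 \<le> (norm (x - v))\<^sup>2"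
proof -
  define f where "f v = (norm (x - v))\<^sup>2" for v
  define d where "d = (INF v\<in>L. f v)"
  have ne: "L \<noteq> {}"
    using assms(1) subspace_0 by auto
  have bdd: "bdd_below (f ` L)"
    by (rule bdd_belowI2[of _ 0]) (simp add: f_def)
  have d_le: "d \<le> f v" if "v \<in> L" for v
    unfolding d_def using bdd that by (rule cINF_lower)
  have "\<exists>v\<in>L. f v < d + inverse (real (Suc n))" for n
    using cINF_less_iff[OF ne bdd, of "d + inverse (real (Suc n))"] by (simp add: d_def)
  then obtain v where v: "v n \<in> L" "f (v n) < d + inverse (real (Suc n))" for n
    by metis
  have dist_v: "(norm (v m - v n))\<^sup>2 < 2 * inverse (real (Suc m)) + 2 * inverse (real (Suc n))"
    for m n
  proof -
    \<comment> \<open>The midpoint lies in \<open>L\<close>, so its squared distance is at least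
      \<open>d\<close>; this bounds the subtracted term of the parallelogram identity.\<close>
    have "(1/2) *\<^sub>R (v m + v n) \<in> L"
      using assms(1) v(1) by (intro subspace_scale subspace_add)
    then have "d \<le> f ((1/2) *\<^sub>R (v m + v n))"
      by (rule d_le)
    moreover have "(norm (v m - v n))\<^sup>2 =
        2 * f (v m) + 2 * f (v n) - 4 * f ((1/2) *\<^sub>R (v m + v n))"
      unfolding f_def power2_norm_eq_inner
      by (simp add: inner_simps inner_commute algebra_simps)
    ultimately show ?thesis
      using v(2)[of m] v(2)[of n] by simp
  qed
  have "Cauchy v"
  proof (rule CauchyI)
    fix e :: real assume "0 < e"
    \<comment> \<open>The divisor 4 puts each of the two terms in \<open>dist_v\<close> below half
      of \<open>e\<^sup>2\<close>.\<close>
    then obtain k where k: "inverse (real (Suc k)) < e\<^sup>2 / 4"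
      using reals_Archimedean[of "e\<^sup>2 / 4"] by auto
    have "norm (v m - v n) < e" if "k \<le> m" "k \<le> n" for m n
    proof -
      have "inverse (real (Suc m)) \<le> inverse (real (Suc k))"
        "inverse (real (Suc n)) \<le> inverse (real (Suc k))"
        using that by (simp_all add: le_imp_inverse_le)
      then have "(norm (v m - v n))\<^sup>2 < e\<^sup>2"
        using dist_v[of m n] k by linarith
      then show ?thesis
        using \<open>0 < e\<close> by (simp add: power_less_imp_less_base)
    qed
    then show "\<exists>M. \<forall>m\<ge>M. \<forall>n\<ge>M. norm (v m - v n) < e"
      by blast
  qed
  then obtain p where p: "v \<longlonglongrightarrow> p"
    using Cauchy_convergent convergent_def by blast
  have "p \<in> L"
    using assms(2) p v(1) closed_sequentially by blast
  moreover have "f p \<le> d"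
  proof (rule LIMSEQ_le)
    show "(\<lambda>n. f (v n)) \<longlonglongrightarrow> f p"
      unfolding f_def by (intro tendsto_intros p)
    show "(\<lambda>n. d + inverse (real (Suc n))) \<longlonglongrightarrow> d"
      using tendsto_add[OF tendsto_const LIMSEQ_inverse_real_of_nat, of d] by simp
    show "\<exists>N. \<forall>n\<ge>N. f (v n) \<le> d + inverse (real (Suc n))"
      using v(2) less_imp_le by blast
  qed
  moreover have "(norm (x - p))\<^sup>2 \<le> (norm (x - v))\<^sup>2" if "v \<in> L" for v
    using order.trans[OF \<open>f p \<le> d\<close> d_le[OF that]] unfolding f_def .
  ultimately show ?thesis
    by blast
qed

lemma ex_projection:
  fixes x :: "'a::chilbert_space"
  assumes "closed_csubspace L"
  shows "\<exists>p\<in>L. x - p \<in> ocompl L"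
proof -
  have L: "csubspace L" "closed L" "subspace L"
    using assms by (simp_all add: closed_csubspaceD csubspace_imp_subspace)
  obtain p where p: "p \<in> L" "\<And>v. v \<in> L \<Longrightarrow> (norm (x - p))\<^sup>2 \<le> (norm (x - v))\<^sup>2"
    using ex_closest_in_subspace[OF L(3,2)] by metis
  have "inner (x - p) v = 0" if "v \<in> L" for v
    by (rule inner_eq_0_if_closest) (intro p subspace_add subspace_scale L that)
  \<comment> \<open>Real orthogonality to \<open>v\<close> and to \<open>\<i> *\<^sub>C v\<close>,
    which is again in \<open>L\<close>, amounts to complex orthogonality to
    \<open>v\<close>.\<close>
  then have "x - p \<in> ocompl L"
    using L(1) by (simp add: ocompl_def cinner_conv_inner complex_vector.subspace_scale
        Complex_eq_0)
  with p(1) show ?thesis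
    by blast
qed

section \<open>Uniqueness, linearity and norm of orthogonal projections\<close>

lemma proj_on_eq:
  assumes "csubspace G" "p \<in> G" "x - p \<in> ocompl G"
  shows "proj_on G x = p"
  unfolding proj_on_def
proof (rule the_equality)
  \<comment> \<open>Two candidates differ by a vector of \<open>G\<close> that is also orthogonal to
    \<open>G\<close>, hence by zero.\<close>
  fix q assume q: "q \<in> G \<and> x - q \<in> ocompl G"
  then have "q - p \<in> G"
    using assms by (simp add: complex_vector.subspace_diff)
  moreover have "(x - p) - (x - q) \<in> ocompl G"
    using q assms(3) csubspace_ocompl complex_vector.subspace_diff by blast
  ultimately show "q = p"
    using ocompl_disjoint[of "q - p" G] by simp
qed (use assms in simp)

lemma
  fixes x :: "'a::chilbert_space"
  assumes "closed_csubspace G"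
  shows proj_on_in: "proj_on G x \<in> G"
    and diff_proj_on_in: "x - proj_on G x \<in> ocompl G"
  using ex_projection[OF assms, of x] proj_on_eq[of G _ x] closed_csubspaceD(1)[OF assms]
  by auto

lemma proj_on_add:
  fixes x :: "'a::chilbert_space"
  assumes "closed_csubspace G"
  shows "proj_on G (x + y) = proj_on G x + proj_on G y"
proof (rule proj_on_eq)
  have "(x - proj_on G x) + (y - proj_on G y) \<in> ocompl G"
    by (intro complex_vector.subspace_add csubspace_ocompl diff_proj_on_in assms)
  then show "x + y - (proj_on G x + proj_on G y) \<in> ocompl G"
    by (simp add: algebra_simps)
qed (use assms in \<open>auto intro: closed_csubspaceD proj_on_in\<close>)

lemma proj_on_scaleC:
  fixes x :: "'a::chilbert_space"
  assumes "closed_csubspace G"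
  shows "proj_on G (c *\<^sub>C x) = c *\<^sub>C proj_on G x"
proof (rule proj_on_eq)
  have "c *\<^sub>C (x - proj_on G x) \<in> ocompl G"
    by (intro complex_vector.subspace_scale csubspace_ocompl diff_proj_on_in assms)
  then show "c *\<^sub>C x - c *\<^sub>C proj_on G x \<in> ocompl G"
    by (simp add: complex_vector.scale_right_diff_distrib)
qed (use assms in \<open>auto intro: closed_csubspaceD proj_on_in\<close>)

lemma proj_on_ocompl:
  fixes x :: "'a::chilbert_space"
  assumes "closed_csubspace G"
  shows "proj_on (ocompl G) x = x - proj_on G x"
proof (rule proj_on_eq)
  \<comment> \<open>The remainder is \<open>proj_on G x\<close>, and vectors of \<open>G\<close> are
    orthogonal to everything in \<open>ocompl G\<close>.\<close>
  show "x - (x - proj_on G x) \<in> ocompl (ocompl G)"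
    using ocomplD'[OF _ proj_on_in[OF assms]] by (simp add: ocompl_def[of "ocompl G"])
qed (auto simp: csubspace_ocompl diff_proj_on_in assms)

lemma norm_square_proj_on:
  fixes x :: "'a::chilbert_space"
  assumes "closed_csubspace G"
  shows "(norm x)\<^sup>2 = (norm (proj_on G x))\<^sup>2 + (norm (proj_on (ocompl G) x))\<^sup>2"
proof -
  have "cinner (proj_on G x) (x - proj_on G x) = 0"
    by (intro ocomplD'[of _ G] diff_proj_on_in proj_on_in assms)
  from norm_add_square_orthogonal[OF this] show ?thesis
    by (simp add: proj_on_ocompl assms)
qed

lemma norm_proj_on_le:
  fixes x :: "'a::chilbert_space"
  assumes "closed_csubspace G"
  shows "norm (proj_on G x) \<le> norm x"
proof (rule power2_le_imp_le)
  show "(norm (proj_on G x))\<^sup>2 \<le> (norm x)\<^sup>2"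
    unfolding norm_square_proj_on[OF assms, of x] by simp
qed simp

section \<open>Sums of subspaces\<close>

lemma subspace_sumI: "x \<in> G \<Longrightarrow> y \<in> K \<Longrightarrow> x + y \<in> G \<^bold>\<oplus> K"
  by (auto simp: subspace_sum_def)

lemma subspace_sumE:
  assumes "x \<in> G \<^bold>\<oplus> K"
  obtains y z where "y \<in> G" "z \<in> K" "x = y + z"
  using assms by (auto simp: subspace_sum_def)

lemma subspace_sum_ocompl:
  fixes G :: "'a::chilbert_space set"
  assumes "closed_csubspace G"
  shows "G \<^bold>\<oplus> ocompl G = UNIV"
proof -
  have "x \<in> G \<^bold>\<oplus> ocompl G" for x
    using subspace_sumI[OF proj_on_in[OF assms] diff_proj_on_in[OF assms], of x x] by simp
  then show ?thesis
    by auto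
qed

lemma csubspace_subspace_sum:
  assumes "csubspace G" "csubspace K"
  shows "csubspace (G \<^bold>\<oplus> K)"
proof -
  have "G \<^bold>\<oplus> K = (\<Union>x\<in>G. \<Union>y\<in>K. {x + y})"
    by (auto simp: subspace_sum_def)
  then show ?thesis
    using complex_vector.subspace_sums[OF assms] by (simp add: subspace_sum_def)
qed

text \<open>Sums of closed subspaces can fail to be closed. Orthogonality puts \<open>K\<close>
  inside \<open>ocompl G\<close>, so that the sum is the preimage of \<open>K\<close> under the
  continuous projection to \<open>ocompl G\<close>.\<close>

lemma closed_csubspace_orthogonal_sum:
  fixes G K :: "'a::chilbert_space set"
  assumes G: "closed_csubspace G" and K: "closed_csubspace K" and "orthogonal_sets G K"
  shows "closed_csubspace (G \<^bold>\<oplus> K)"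
proof -
  have K_sub: "K \<subseteq> ocompl G"
    using assms(3)
    by (auto simp: orthogonal_sets_def ocompl_def intro: cinner_eq_0_commute[THEN iffD1])
  have "G \<^bold>\<oplus> K = proj_on (ocompl G) -` K"
  proof (intro subset_antisym subsetI)
    fix x assume "x \<in> G \<^bold>\<oplus> K"
    then obtain y z where yz: "y \<in> G" "z \<in> K" "x = y + z"
      by (rule subspace_sumE)
    then have "proj_on G x = y"
      using G K_sub by (intro proj_on_eq) (auto simp: closed_csubspaceD)
    then show "x \<in> proj_on (ocompl G) -` K"
      using yz by (simp add: proj_on_ocompl G)
  next
    fix x assume "x \<in> proj_on (ocompl G) -` K"
    then show "x \<in> G \<^bold>\<oplus> K"
      using subspace_sumI[OF proj_on_in[OF G], of "proj_on (ocompl G) x" K x]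
      by (simp add: proj_on_ocompl G)
  qed
  moreover have "bounded_linear (proj_on (ocompl G))"
  proof (rule bounded_linear_intro[where K = 1])
    fix r and x :: 'a
    show "proj_on (ocompl G) (r *\<^sub>R x) = r *\<^sub>R proj_on (ocompl G) x"
      using proj_on_scaleC[OF closed_csubspace_ocompl[of G], of "of_real r" x]
      by (simp add: scaleC_of_real)
  qed (simp_all add: proj_on_add closed_csubspace_ocompl norm_proj_on_le)
  then have "closed (proj_on (ocompl G) -` K)"
    using closed_csubspaceD(2)[OF K] by (intro closed_vimage linear_continuous_on)
  ultimately show ?thesis
    using csubspace_subspace_sum[OF closed_csubspaceD(1)[OF G] closed_csubspaceD(1)[OF K]]
    by (simp add: closed_csubspace_def)
qed

section \<open>Operators between closed subspaces\<close>

lemma bounded_op_onD: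
  assumes "bounded_op_on G K A"
  shows "x \<in> G \<Longrightarrow> A x \<in> K"
    and "x \<in> G \<Longrightarrow> y \<in> G \<Longrightarrow> A (x + y) = A x + A y"
    and "x \<in> G \<Longrightarrow> A (c *\<^sub>C x) = c *\<^sub>C A x"
  using assms by (auto simp: bounded_op_on_def)

lemma bounded_op_on_0:
  assumes "bounded_op_on G K A" "0 \<in> G"
  shows "A 0 = 0"
  using bounded_op_onD(3)[OF assms, of 0] by simp

lemma bounded_op_on_diff:
  assumes "bounded_op_on G K A" "csubspace G" "x \<in> G" "y \<in> G"
  shows "A (x - y) = A x - A y"
  using bounded_op_onD(2)[OF assms(1) complex_vector.subspace_diff[OF assms(2-4)] assms(4)]
  by simp

lemma bounded_op_on_continuous_on:
  assumes "bounded_op_on G K A" "csubspace G"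
  shows "continuous_on G A"
proof -
  obtain B where B: "\<And>x. x \<in> G \<Longrightarrow> norm (A x) \<le> B * norm x"
    using assms(1) unfolding bounded_op_on_def by blast
  \<comment> \<open>\<open>B\<close> may be negative when \<open>G\<close> contains only 0, whereas
    a Lipschitz constant may not; hence the absolute value.\<close>
  have "dist (A x) (A y) \<le> \<bar>B\<bar> * dist x y" if "x \<in> G" "y \<in> G" for x y
  proof -
    have "dist (A x) (A y) \<le> B * norm (x - y)"
      using B[of "x - y"] that assms
      by (simp add: dist_norm bounded_op_on_diff complex_vector.subspace_diff)
    also have "\<dots> \<le> \<bar>B\<bar> * dist x y"
      by (simp add: dist_norm mult_right_mono)
    finally show ?thesis .
  qed
  then have "\<bar>B\<bar>-lipschitz_on G A"
    by (intro lipschitz_onI) auto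
  then show ?thesis
    by (rule lipschitz_on_continuous_on)
qed

text \<open>A real supremum is sure to bound its members only for a set bounded above, so the
  boundedness of \<open>A\<close> is what makes \<open>onorm_on\<close> usable here. The point 0
  makes the set nonempty for the converse; its quotient is 0 by the convention on division by
  zero.\<close>

lemma contraction_on_iff:
  assumes "0 \<in> G"
  shows "contraction_on G K A \<longleftrightarrow> bounded_op_on G K A \<and> (\<forall>x\<in>G. norm (A x) \<le> norm x)"
proof (intro iffI conjI ballI)
  assume A: "contraction_on G K A"
  then show bop: "bounded_op_on G K A"
    by (simp add: contraction_on_def)
  then obtain B where B: "\<And>x. x \<in> G \<Longrightarrow> norm (A x) \<le> B * norm x"
    unfolding bounded_op_on_def by blast
  have "norm (A x) / norm x \<le> \<bar>B\<bar>" if "x \<in> G" for x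
    using B[OF that] by (cases "x = 0") (auto simp: field_simps intro: order.trans mult_left_mono)
  then have bdd: "bdd_above ((\<lambda>x. norm (A x) / norm x) ` G)"
    by (intro bdd_aboveI2)
  fix x assume x: "x \<in> G"
  have "norm (A x) / norm x \<le> 1"
    using cSUP_upper[OF x bdd] A by (simp add: contraction_on_def onorm_on_def)
  then show "norm (A x) \<le> norm x"
    using bounded_op_on_0[OF bop assms] by (cases "x = 0") (simp_all add: divide_le_eq)
next
  assume A: "bounded_op_on G K A \<and> (\<forall>x\<in>G. norm (A x) \<le> norm x)"
  then have "norm (A x) / norm x \<le> 1" if "x \<in> G" for x
    using that by (simp add: divide_le_eq_1)
  then have "onorm_on G A \<le> 1"
    unfolding onorm_on_def using assms by (intro cSUP_least) auto
  with A show "contraction_on G K A"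
    by (simp add: contraction_on_def)
qed

lemma contraction_onI:
  assumes "0 \<in> G" "\<And>x. x \<in> G \<Longrightarrow> A x \<in> K"
    and "\<And>x y. x \<in> G \<Longrightarrow> y \<in> G \<Longrightarrow> A (x + y) = A x + A y"
    and "\<And>c x. x \<in> G \<Longrightarrow> A (c *\<^sub>C x) = c *\<^sub>C A x"
    and "\<And>x. x \<in> G \<Longrightarrow> norm (A x) \<le> norm x"
  shows "contraction_on G K A"
  using assms by (auto simp: contraction_on_iff bounded_op_on_def intro!: exI[of _ 1])

section \<open>Adjoints\<close>

lemma adj_on_eq:
  assumes "csubspace G" "y \<in> K" "z \<in> G" "\<And>x. x \<in> G \<Longrightarrow> cinner (A x) y = cinner x z"
  shows "adj_on G K A y = z"
proof -
  have "(THE z. z \<in> G \<and> (\<forall>x\<in>G. cinner (A x) y = cinner x z)) = z"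
  proof (rule the_equality)
    \<comment> \<open>The difference of two representing vectors lies in \<open>G\<close>, so
      testing against it shows that it is orthogonal to itself.\<close>
    fix z' assume z': "z' \<in> G \<and> (\<forall>x\<in>G. cinner (A x) y = cinner x z')"
    then have "z' - z \<in> G"
      using assms by (simp add: complex_vector.subspace_diff)
    then have "cinner (z' - z) (z' - z) = 0"
      using z' assms(4) by (metis cinner_diff_right diff_self)
    then show "z' = z"
      by simp
  qed (use assms in simp)
  then show ?thesis
    using assms(2) by (simp add: adj_on_def)
qed

text \<open>This is the Riesz representation of the functional \<open>x \<mapsto> cinner (A x) y\<close> on \<open>G\<close>.\<close>

lemma ex_adj_on:
  fixes A :: "'a::chilbert_space \<Rightarrow> 'b::complex_inner"
  assumes G: "closed_csubspace G" and A: "bounded_op_on G K A"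
  shows "\<exists>z\<in>G. \<forall>x\<in>G. cinner (A x) y = cinner x z"
proof -
  define f where "f x = cinner (A x) y" for x
  define L where "L = G \<inter> f -` {0}"
  note G' = closed_csubspaceD[OF G]
  have "continuous_on G f"
    unfolding f_def using A G'(1) by (intro continuous_intros bounded_op_on_continuous_on)
  then have "closed L"
    unfolding L_def using G'(2) by (intro continuous_closed_preimage) auto
  moreover have "csubspace L"
    unfolding complex_vector.subspace_def L_def f_def
    using G' bounded_op_onD[OF A] bounded_op_on_0[OF A]
    by (auto simp: cinner_add_left cinner_scaleC_left)
  ultimately have L: "closed_csubspace L"
    by (simp add: closed_csubspace_def)
  show ?thesis
  proof (cases "G \<subseteq> L")
    case True
    then show ?thesis
      using G'(3) by (auto simp: L_def f_def intro!: bexI[of _ 0])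
  next
    case False
    then obtain u where u: "u \<in> G" "u \<notin> L"
      by auto
    \<comment> \<open>The kernel \<open>L\<close> of \<open>f\<close> is here a proper closed
      subspace of \<open>G\<close>, so removing the projection to it from \<open>u\<close> leaves a
      nonzero vector orthogonal to the kernel.\<close>
    define w where "w = u - proj_on L u"
    have "proj_on L u \<in> L"
      by (rule proj_on_in[OF L])
    then have w: "w \<in> G" "w \<noteq> 0"
      using u G'(5) by (auto simp: w_def L_def)
    have w_ortho: "w \<in> ocompl L"
      unfolding w_def by (rule diff_proj_on_in[OF L])
    then have fw: "f w \<noteq> 0"
      using w ocompl_disjoint[of w L] by (auto simp: L_def)
    \<comment> \<open>The factor gives \<open>cinner w z = f w\<close>; it is conjugated because the
      second argument of \<open>cinner\<close> is conjugate linear.\<close>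
    define z where "z = cnj (f w / cinner w w) *\<^sub>C w"
    have "cinner (A x) y = cinner x z" if x: "x \<in> G" for x
    proof -
      \<comment> \<open>Every \<open>x\<close> in \<open>G\<close> is a multiple of \<open>w\<close>
        plus a vector of the kernel, so agreement at \<open>w\<close> suffices.\<close>
      have "f (x - (f x / f w) *\<^sub>C w) = 0"
        using x w fw G' by (simp add: f_def bounded_op_on_diff[OF A] bounded_op_onD[OF A]
            cinner_diff_left cinner_scaleC_left)
      then have "x - (f x / f w) *\<^sub>C w \<in> L"
        using x w G' by (simp add: L_def)
      then have "cinner (x - (f x / f w) *\<^sub>C w) w = 0"
        using w_ortho by (rule ocomplD'[rotated])
      then have "cinner x w = f x / f w * cinner w w"
        by (simp add: cinner_diff_left cinner_scaleC_left)
      then show ?thesis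
        using fw w by (simp add: z_def cinner_scaleC_right f_def)
    qed
    moreover have "z \<in> G"
      using w G' by (simp add: z_def)
    ultimately show ?thesis
      by blast
  qed
qed

text \<open>Once a representing vector exists, uniqueness makes the \<open>THE\<close> in
  \<open>adj_on\<close> denote it.\<close>

lemma
  fixes A :: "'a::chilbert_space \<Rightarrow> 'b::complex_inner"
  assumes "closed_csubspace G" "bounded_op_on G K A" "y \<in> K"
  shows adj_on_in: "adj_on G K A y \<in> G"
    and cinner_adj_on: "x \<in> G \<Longrightarrow> cinner (A x) y = cinner x (adj_on G K A y)"
proof -
  obtain z where "z \<in> G" "\<And>x. x \<in> G \<Longrightarrow> cinner (A x) y = cinner x z"
    using ex_adj_on[OF assms(1,2)] by blast
  moreover from this have "adj_on G K A y = z"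
    using assms by (intro adj_on_eq) (auto simp: closed_csubspaceD)
  ultimately show "adj_on G K A y \<in> G"
    and "x \<in> G \<Longrightarrow> cinner (A x) y = cinner x (adj_on G K A y)"
    by auto
qed

section \<open>The kernel of \<open>I - A*A\<close> and partial isometries\<close>

lemma defect_null_iff_cinner:
  fixes A :: "'a::chilbert_space \<Rightarrow> 'b::complex_inner"
  assumes G: "closed_csubspace G" and A: "bounded_op_on G K A"
  shows "x \<in> defect_null G K A \<longleftrightarrow> x \<in> G \<and> (\<forall>y\<in>G. cinner (A y) (A x) = cinner y x)"
proof -
  \<comment> \<open>By uniqueness, \<open>A*A x = x\<close> means that \<open>x\<close> itself
    represents the functional \<open>y \<mapsto> cinner (A y) (A x)\<close>. This is a linear
    condition on \<open>x\<close> that mentions no adjoint.\<close>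
  have "adj_on G K A (A x) = x \<longleftrightarrow> (\<forall>y\<in>G. cinner (A y) (A x) = cinner y x)" if "x \<in> G"
    using adj_on_eq[of G "A x" K x A] cinner_adj_on[OF G A] bounded_op_onD(1)[OF A] that G
    by (auto simp: closed_csubspaceD)
  then show ?thesis
    by (auto simp: defect_null_def null_space_def)
qed

text \<open>For \<open>z = A*A x\<close>, preservation of the norm gives
  \<open>inner x z = (norm x)\<^sup>2\<close>, and contractivity gives
  \<open>norm z \<le> norm x\<close>; together they force \<open>norm (x - z) = 0\<close>. The
  converse is the case \<open>y = x\<close> of the inner product criterion.\<close>

lemma defect_null_iff_norm:
  fixes A :: "'a::chilbert_space \<Rightarrow> 'b::complex_inner"
  assumes G: "closed_csubspace G" and A: "contraction_on G K A"
  shows "x \<in> defect_null G K A \<longleftrightarrow> x \<in> G \<and> norm (A x) = norm x"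
proof -
  have bop: "bounded_op_on G K A" and le: "\<And>y. y \<in> G \<Longrightarrow> norm (A y) \<le> norm y"
    using A closed_csubspaceD(3)[OF G] by (simp_all add: contraction_on_iff)
  have "norm (A x) = norm x" if "x \<in> defect_null G K A"
  proof -
    have "inner (A x) (A x) = inner x x"
      using that defect_null_iff_cinner[OF G bop] by (metis Re_cinner)
    then show ?thesis
      by (simp add: norm_eq_sqrt_inner)
  qed
  moreover have "x \<in> defect_null G K A" if x: "x \<in> G" and eq: "norm (A x) = norm x"
  proof -
    define z where "z = adj_on G K A (A x)"
    have z: "z \<in> G" "\<And>y. y \<in> G \<Longrightarrow> cinner (A y) (A x) = cinner y z"
      using x bounded_op_onD(1)[OF bop] by (simp_all add: z_def adj_on_in[OF G bop]
          cinner_adj_on[OF G bop])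
    \<comment> \<open>The defining property of the adjoint is tested at \<open>z\<close> itself; one
      factor \<open>norm z\<close> is cancelled later.\<close>
    have "norm z * norm z = inner (A z) (A x)"
      using z(2)[OF z(1)] by (metis Re_cinner power2_eq_square power2_norm_eq_inner)
    also have "\<dots> \<le> norm (A z) * norm (A x)"
      by (rule norm_cauchy_schwarz)
    also have "\<dots> \<le> norm z * norm x"
      using le[OF z(1)] eq by (simp add: mult_right_mono)
    finally have "norm z \<le> norm x"
      by (cases "z = 0") auto
    then have "(norm z)\<^sup>2 \<le> (norm x)\<^sup>2"
      by simp
    moreover have "inner x z = (norm x)\<^sup>2"
      using z(2)[OF x] eq by (metis Re_cinner power2_norm_eq_inner)
    moreover have "(norm (x - z))\<^sup>2 = (norm x)\<^sup>2 - 2 * inner x z + (norm z)\<^sup>2"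
      by (simp add: power2_norm_eq_inner inner_simps inner_commute)
    ultimately have "(norm (x - z))\<^sup>2 \<le> 0"
      by simp
    then have "z = x"
      by simp
    with z x show ?thesis
      by (simp add: defect_null_iff_cinner[OF G bop])
  qed
  ultimately show ?thesis
    using defect_null_iff_cinner[OF G bop] by blast
qed

text \<open>Closedness is read off the norm criterion, linearity off the inner product
  criterion.\<close>

lemma closed_csubspace_defect_null:
  fixes A :: "'a::chilbert_space \<Rightarrow> 'b::complex_inner"
  assumes G: "closed_csubspace G" and A: "contraction_on G K A"
  shows "closed_csubspace (defect_null G K A)"
proof -
  have bop: "bounded_op_on G K A"
    using A by (simp add: contraction_on_def)
  note G' = closed_csubspaceD[OF G]
  have "continuous_on G A"
    using bop G'(1) by (rule bounded_op_on_continuous_on)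
  then have "closed (G \<inter> (\<lambda>x. norm (A x) - norm x) -` {0})"
    using G'(2) by (intro continuous_closed_preimage continuous_intros) auto
  moreover have "defect_null G K A = G \<inter> (\<lambda>x. norm (A x) - norm x) -` {0}"
    by (auto simp: defect_null_iff_norm[OF G A])
  moreover have "csubspace (defect_null G K A)"
    unfolding complex_vector.subspace_def using G' bounded_op_onD[OF bop] bounded_op_on_0[OF bop]
    by (auto simp: defect_null_iff_cinner[OF G bop] cinner_add_right cinner_scaleC_right)
  ultimately show ?thesis
    by (simp add: closed_csubspace_def)
qed

lemma closed_csubspace_null_space:
  assumes G: "closed_csubspace G" and A: "bounded_op_on G K A"
  shows "closed_csubspace (null_space G A)"
proof -
  note G' = closed_csubspaceD[OF G]
  have "closed (G \<inter> A -` {0})"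
    using bounded_op_on_continuous_on[OF A G'(1)] G'(2)
    by (intro continuous_closed_preimage) auto
  moreover have "null_space G A = G \<inter> A -` {0}"
    by (auto simp: null_space_def)
  moreover have "csubspace (null_space G A)"
    unfolding complex_vector.subspace_def using G' bounded_op_onD[OF A] bounded_op_on_0[OF A]
    by (auto simp: null_space_def)
  ultimately show ?thesis
    by (simp add: closed_csubspace_def)
qed

text \<open>For \<open>x\<close> in the kernel and \<open>y\<close> in the defect space,
  \<open>cinner x y = cinner (A x) (A y) = 0\<close>.\<close>

lemma orthogonal_null_defect:
  fixes A :: "'a::chilbert_space \<Rightarrow> 'b::complex_inner"
  assumes "closed_csubspace G" "bounded_op_on G K A"
  shows "orthogonal_sets (null_space G A) (defect_null G K A)"
  using assms by (fastforce simp: orthogonal_sets_def null_space_def defect_null_iff_cinner)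

text \<open>If \<open>A*A\<close> projects onto \<open>S\<close>, it fixes \<open>S\<close> and
  kills the complement of \<open>S\<close> in \<open>G\<close>, which splits \<open>G\<close> as
  claimed. Conversely, orthogonality of the two summands makes \<open>A*A\<close> the projection
  onto the second one.\<close>

lemma partial_isometry_on_iff:
  fixes A :: "'a::chilbert_space \<Rightarrow> 'b::complex_inner"
  assumes G: "closed_csubspace G" and A: "contraction_on G K A"
  shows "partial_isometry_on G K A \<longleftrightarrow> G \<subseteq> null_space G A \<^bold>\<oplus> defect_null G K A"
proof
  have bop: "bounded_op_on G K A"
    using A by (simp add: contraction_on_def)
  note G' = closed_csubspaceD[OF G]
  assume "partial_isometry_on G K A"
  then obtain S where S: "closed_csubspace S" "S \<subseteq> G"
    and P: "\<And>x. x \<in> G \<Longrightarrow> adj_on G K A (A x) = proj_on S x"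
    by (auto simp: partial_isometry_on_def orth_projection_on_def)
  show "G \<subseteq> null_space G A \<^bold>\<oplus> defect_null G K A"
  proof
    fix x assume x: "x \<in> G"
    define p where "p = proj_on S x"
    have p: "p \<in> S" "x - p \<in> ocompl S"
      using S(1) by (simp_all add: p_def proj_on_in diff_proj_on_in)
    have pG: "p \<in> G" "x - p \<in> G"
      using p(1) S(2) x G' by auto
    have "proj_on S p = p"
      using p(1) S(1) closed_csubspaceD(3)[OF closed_csubspace_ocompl]
      by (intro proj_on_eq) (auto simp: closed_csubspaceD)
    then have "p \<in> defect_null G K A"
      using P[OF pG(1)] pG by (simp add: defect_null_def null_space_def)
    moreover have "proj_on S (x - p) = 0"
      using p S(1) by (intro proj_on_eq) (auto simp: closed_csubspaceD)
    \<comment> \<open>By the adjoint, this is the inner product of \<open>x - p\<close> with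
      \<open>A*A (x - p)\<close>, and the latter vector is 0.\<close>
    then have "cinner (A (x - p)) (A (x - p)) = 0"
      using P[OF pG(2)] cinner_adj_on[OF G bop bounded_op_onD(1)[OF bop pG(2)] pG(2)] by simp
    then have "x - p \<in> null_space G A"
      using pG by (simp add: null_space_def)
    ultimately show "x \<in> null_space G A \<^bold>\<oplus> defect_null G K A"
      using subspace_sumI[of "x - p" "null_space G A" p] by simp
  qed
next
  have bop: "bounded_op_on G K A"
    using A by (simp add: contraction_on_def)
  note G' = closed_csubspaceD[OF G]
  define S where "S = defect_null G K A"
  have S: "closed_csubspace S"
    unfolding S_def using G A by (rule closed_csubspace_defect_null)
  assume sub: "G \<subseteq> null_space G A \<^bold>\<oplus> defect_null G K A"
  have "adj_on G K A (A x) = proj_on S x" if x: "x \<in> G" for x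
  proof -
    obtain n d where nd: "n \<in> null_space G A" "d \<in> S" "x = n + d"
      using subspace_sumE[OF subsetD[OF sub x]] unfolding S_def by blast
    have n: "n \<in> G" "A n = 0" and d: "d \<in> G" "\<And>y. y \<in> G \<Longrightarrow> cinner (A y) (A d) = cinner y d"
      using nd by (auto simp: null_space_def S_def defect_null_iff_cinner[OF G bop])
    have "A x = A d"
      using n d nd(3) by (simp add: bounded_op_onD[OF bop])
    then have "adj_on G K A (A x) = d"
      using d bounded_op_onD(1)[OF bop] G' by (intro adj_on_eq) auto
    moreover have "proj_on S x = d"
    proof (rule proj_on_eq)
      show "x - d \<in> ocompl S"
        using orthogonal_null_defect[OF G bop] nd
        by (simp add: S_def ocompl_def orthogonal_sets_def)
    qed (use nd S in \<open>auto simp: closed_csubspaceD\<close>)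
    ultimately show ?thesis
      by simp
  qed
  moreover have "S \<subseteq> G"
    by (auto simp: S_def defect_null_def null_space_def)
  ultimately show "partial_isometry_on G K A"
    using bop S by (auto simp: partial_isometry_on_def orth_projection_on_def)
qed

section \<open>Invariant subspaces of a contraction\<close>

lemma contraction_on_restrict:
  assumes "contraction_on UNIV UNIV T" "closed_csubspace G" "invariant_for T G"
  shows "contraction_on G G (restrict T G)"
  using assms closed_csubspaceD[OF assms(2)]
  by (intro contraction_onI)
    (auto simp: contraction_on_iff invariant_for_def bounded_op_onD image_subset_iff)

text \<open>The adjoint of \<open>restrict T G\<close> is in general not the restriction of the
  adjoint of \<open>T\<close>. The norm criterion avoids comparing them: both kernels of the
  restriction are those of \<open>T\<close> cut down to \<open>G\<close>.\<close>

lemma pi_invariant_iff: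
  fixes T :: "'a::chilbert_space \<Rightarrow> 'a"
  assumes T: "contraction_on UNIV UNIV T"
  shows "pi_invariant T G \<longleftrightarrow> closed_csubspace G \<and> invariant_for T G \<and>
    G \<subseteq> (null_space UNIV T \<inter> G) \<^bold>\<oplus> (defect_null UNIV UNIV T \<inter> G)"
proof -
  have "partial_isometry_on G G (restrict T G) \<longleftrightarrow>
      G \<subseteq> (null_space UNIV T \<inter> G) \<^bold>\<oplus> (defect_null UNIV UNIV T \<inter> G)"
    if G: "closed_csubspace G" "invariant_for T G"
  proof -
    have W: "contraction_on G G (restrict T G)"
      using T G by (rule contraction_on_restrict)
    have "null_space G (restrict T G) = null_space UNIV T \<inter> G"
      by (auto simp: null_space_def)
    moreover have "defect_null G G (restrict T G) = defect_null UNIV UNIV T \<inter> G"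
      by (auto simp: defect_null_iff_norm[OF G(1) W] defect_null_iff_norm[OF closed_csubspace_UNIV T])
    ultimately show ?thesis
      using partial_isometry_on_iff[OF G(1) W] by simp
  qed
  then show ?thesis
    by (auto simp: pi_invariant_def)
qed

lemma contraction_on_compression:
  fixes T :: "'a::chilbert_space \<Rightarrow> 'a"
  assumes T: "contraction_on UNIV UNIV T" and G: "closed_csubspace G" and K: "closed_csubspace K"
  shows "contraction_on G K (compression G K T)"
proof (rule contraction_onI)
  fix x assume "x \<in> G"
  then show "norm (compression G K T x) \<le> norm x"
    using T norm_proj_on_le[OF K, of "T x"]
    by (auto simp: compression_def contraction_on_iff intro: order.trans)
qed (use T closed_csubspaceD[OF G] in \<open>auto simp: compression_def contraction_on_iff
    bounded_op_onD proj_on_in proj_on_add proj_on_scaleC K\<close>)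

lemma closed_csubspace_vimage:
  assumes A: "bounded_op_on UNIV UNIV A" and G: "closed_csubspace G"
  shows "closed_csubspace (A -` G)"
proof -
  have "continuous_on UNIV A"
    using A by (rule bounded_op_on_continuous_on) simp
  then have "closed (A -` G)"
    using closed_vimage[of G A] closed_csubspaceD(2)[OF G] by simp
  moreover have "csubspace (A -` G)"
    unfolding complex_vector.subspace_def using closed_csubspaceD[OF G] bounded_op_onD[OF A]
      bounded_op_on_0[OF A]
    by auto
  ultimately show ?thesis
    by (simp add: closed_csubspace_def)
qed

lemma closed_csubspace_INT:
  "(\<And>i. i \<in> I \<Longrightarrow> closed_csubspace (G i)) \<Longrightarrow> closed_csubspace (\<Inter>i\<in>I. G i)"
  by (auto simp: closed_csubspace_def intro!: complex_vector.subspace_Inter)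

lemma closed_csubspace_funpow_vimage:
  fixes T :: "'a::complex_inner \<Rightarrow> 'a"
  assumes "bounded_op_on UNIV UNIV T" "closed_csubspace G"
  shows "closed_csubspace ((T ^^ n) -` G)"
proof (induction n)
  case (Suc n)
  \<comment> \<open>\<open>T\<close> is split off as the innermost factor of the power, so that the
    preimage under \<open>T\<close> is taken last.\<close>
  have "(T ^^ Suc n) -` G = T -` ((T ^^ n) -` G)"
    by (simp add: vimage_comp funpow_Suc_right del: funpow.simps)
  then show ?case
    using closed_csubspace_vimage[OF assms(1) Suc.IH] by (simp only:)
qed (use assms in simp)

theorem theorem2p1:
  fixes T :: "'a::chilbert_space \<Rightarrow> 'a"
  assumes "contraction_on UNIV UNIV T"
  shows "\<exists>M. pi_invariant T M \<and> (\<forall>G. pi_invariant T G \<longrightarrow> G \<subseteq> M) \<and>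
    orthogonal_sets (null_space UNIV T) (defect_null UNIV UNIV T) \<and>
    null_space UNIV T \<subseteq> M \<and>
    M \<subseteq> null_space UNIV T \<^bold>\<oplus> defect_null UNIV UNIV T \<and>
    (let W = restrict T M;
         R = compression (ocompl M) M T;
         Q = compression (ocompl M) (ocompl M) T
     in has_block_matrix T M W R (\<lambda>_. 0) Q \<and>
        partial_isometry_on M M W \<and>
        contraction_on (ocompl M) M R \<and>
        (\<forall>y\<in>ocompl M. adj_on M M W (R y) = 0) \<and>
        contraction_on (ocompl M) (ocompl M) Q \<and>
        defect_null (ocompl M) (ocompl M) Q \<subseteq> defect_null UNIV UNIV T \<and>
        orthogonal_sets M (defect_null (ocompl M) (ocompl M) Q) \<and>
        (null_space UNIV T \<^bold>\<oplus> defect_null UNIV UNIV T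
            = M \<^bold>\<oplus> defect_null (ocompl M) (ocompl M) Q
          \<longleftrightarrow> defect_null UNIV UNIV T \<inter> ocompl M \<subseteq> null_space (ocompl M) R))"
proof -

  \<comment> \<open>Kernel and norm-preserving space of the contraction\<close>
  define N where "N = null_space UNIV T"
  define D where "D = defect_null UNIV UNIV T"
  define M where "M = (\<Inter>n. (T ^^ n) -` (N \<^bold>\<oplus> D))"
  define R where "R = compression (ocompl M) M T"
  define Q where "Q = compression (ocompl M) (ocompl M) T"
  define E where "E = defect_null (ocompl M) (ocompl M) Q"
  note T = assms
  have bop: "bounded_op_on UNIV UNIV T"
    using T by (simp add: contraction_on_def)
  have T_le: "norm (T x) \<le> norm x" for x
    using T by (simp add: contraction_on_iff)
  have T_lin: "T (x + y) = T x + T y" for x y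
    using bounded_op_onD(2)[OF bop] by simp
  have T0: "T 0 = 0"
    using bounded_op_on_0[OF bop] by simp
  have N_iff: "x \<in> N \<longleftrightarrow> T x = 0" for x
    by (simp add: N_def null_space_def)
  have D_iff: "x \<in> D \<longleftrightarrow> norm (T x) = norm x" for x
    by (simp add: D_def defect_null_iff_norm[OF closed_csubspace_UNIV T])
  have D_cinner: "cinner (T y) (T x) = cinner y x" if "x \<in> D" for x y
    using that by (simp add: D_def defect_null_iff_cinner[OF closed_csubspace_UNIV bop])
  have N: "closed_csubspace N" and D: "closed_csubspace D" and ND: "orthogonal_sets N D"
    unfolding N_def D_def
    using closed_csubspace_null_space[OF closed_csubspace_UNIV bop]
      closed_csubspace_defect_null[OF closed_csubspace_UNIV T]
      orthogonal_null_defect[OF closed_csubspace_UNIV bop]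
    by blast+
  have sum: "closed_csubspace (N \<^bold>\<oplus> D)"
    using N D ND by (rule closed_csubspace_orthogonal_sum)

  \<comment> \<open>The maximum invariant subspace\<close>
  have M: "closed_csubspace M"
    unfolding M_def by (intro closed_csubspace_INT closed_csubspace_funpow_vimage bop sum)
  note M' = closed_csubspaceD[OF M]
  have M_iff: "x \<in> M \<longleftrightarrow> (\<forall>n. (T ^^ n) x \<in> N \<^bold>\<oplus> D)" for x
    by (simp add: M_def)
  have inv: "T x \<in> M" if "x \<in> M" for x
  proof -
    have "(T ^^ n) (T x) \<in> N \<^bold>\<oplus> D" for n
      using that M_iff[of x] by (metis funpow_Suc_right o_apply)
    then show ?thesis
      by (simp add: M_iff)
  qed
  have M_sub: "M \<subseteq> N \<^bold>\<oplus> D"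
  proof
    fix x assume "x \<in> M"
    then have "(T ^^ 0) x \<in> N \<^bold>\<oplus> D"
      using M_iff by blast
    then show "x \<in> N \<^bold>\<oplus> D"
      by simp
  qed
  have N_sub: "N \<subseteq> M"
  proof
    fix x assume x: "x \<in> N"
    have "(T ^^ n) x \<in> N" for n
    proof (induction n)
      case (Suc n)
      then show ?case
        by (simp add: N_iff T0)
    qed (use x in simp)
    then have "(T ^^ n) x + 0 \<in> N \<^bold>\<oplus> D" for n
      using closed_csubspaceD(3)[OF D] by (intro subspace_sumI)
    then show "x \<in> M"
      by (simp add: M_iff)
  qed
  \<comment> \<open>Since \<open>N\<close> lies in \<open>M\<close>, subtracting the kernel
    component does not leave \<open>M\<close>. So the splitting of \<open>M\<close> takes place
    inside \<open>M\<close>, as the criterion for a partial isometry on \<open>M\<close>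
    demands.\<close>
  have M_decomp: "\<exists>n d. n \<in> N \<and> d \<in> D \<and> d \<in> M \<and> x = n + d" if x: "x \<in> M" for x
  proof -
    obtain n d where nd: "n \<in> N" "d \<in> D" "x = n + d"
      using subspace_sumE[OF subsetD[OF M_sub x]] by blast
    then have "x - n \<in> M"
      using N_sub x by (intro M') auto
    with nd show ?thesis
      by auto
  qed
  have "M \<subseteq> (N \<inter> M) \<^bold>\<oplus> (D \<inter> M)"
    using M_decomp N_sub by (fastforce simp: subspace_sum_def)
  then have pi_M: "pi_invariant T M"
    using M inv pi_invariant_iff[OF T, of M]
    by (auto simp: invariant_for_def N_def D_def)
  \<comment> \<open>The orbit of a vector of \<open>G\<close> stays in \<open>G\<close>, hence in
    the sum of \<open>N\<close> and \<open>D\<close>.\<close>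
  have max: "G \<subseteq> M" if "pi_invariant T G" for G
  proof
    fix x assume x: "x \<in> G"
    have G: "T ` G \<subseteq> G" "G \<subseteq> (N \<inter> G) \<^bold>\<oplus> (D \<inter> G)"
      using that pi_invariant_iff[OF T, of G] by (auto simp: invariant_for_def N_def D_def)
    have "(T ^^ n) x \<in> G" for n
      using x G(1) by (induction n) auto
    then show "x \<in> M"
      using G(2) by (fastforce simp: M_iff subspace_sum_def)
  qed

  \<comment> \<open>The block matrix and its entries\<close>
  have R: "contraction_on (ocompl M) M R" and Q: "contraction_on (ocompl M) (ocompl M) Q"
    unfolding R_def Q_def by (rule contraction_on_compression[OF T closed_csubspace_ocompl]
        M closed_csubspace_ocompl)+
  have RQ: "R y = proj_on M (T y)" "Q y = proj_on (ocompl M) (T y)" if "y \<in> ocompl M" for y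
    using that by (simp_all add: R_def Q_def compression_def)
  have T_RQ: "T y = R y + Q y" if "y \<in> ocompl M" for y
    using that by (simp add: RQ proj_on_ocompl M)
  have norm_T: "(norm (T y))\<^sup>2 = (norm (R y))\<^sup>2 + (norm (Q y))\<^sup>2" if "y \<in> ocompl M" for y
    unfolding RQ[OF that] by (rule norm_square_proj_on[OF M])
  have W: "contraction_on M M (restrict T M)" "partial_isometry_on M M (restrict T M)"
    using pi_M contraction_on_restrict[OF T] by (auto simp: pi_invariant_def)
  \<comment> \<open>Invariance of \<open>M\<close> is what makes the lower left entry zero; 0 serves
    as a bound for that entry.\<close>
  have block: "has_block_matrix T M (restrict T M) R (\<lambda>_. 0) Q"
    using W(1) R Q subspace_sum_ocompl[OF M] closed_csubspaceD(3)[OF closed_csubspace_ocompl]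
    by (auto simp: has_block_matrix_def contraction_on_def T_lin T_RQ)
      (auto simp: bounded_op_on_def intro!: exI[of _ 0])
  \<comment> \<open>Pairing \<open>T x\<close> with \<open>R y\<close> is the same as pairing it
    with \<open>T y\<close>, because \<open>Q y\<close> is orthogonal to \<open>M\<close>. Only the
    component \<open>d\<close> of \<open>x\<close> survives under \<open>T\<close>, and
    \<open>T\<close> preserves inner products with \<open>d\<close>, so the result is
    \<open>cinner d y = 0\<close>.\<close>
  have adj_WR: "adj_on M M (restrict T M) (R y) = 0" if y: "y \<in> ocompl M" for y
  proof (rule adj_on_eq)
    show "R y \<in> M"
      using y by (simp add: RQ proj_on_in M)
    fix x assume x: "x \<in> M"
    obtain n d where nd: "n \<in> N" "d \<in> D" "d \<in> M" "x = n + d"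
      using M_decomp[OF x] by blast
    have "cinner (T x) (Q y) = 0"
      using inv[OF x] y by (intro ocomplD') (auto simp: RQ proj_on_in closed_csubspace_ocompl)
    then have "cinner (T x) (R y) = cinner (T x) (T y)"
      by (simp add: T_RQ[OF y] cinner_add_right)
    also have "\<dots> = cinner (T d) (T y)"
      using nd by (simp add: T_lin N_iff)
    also have "\<dots> = cinner d y"
      \<comment> \<open>\<open>D_cinner\<close> has the vector of \<open>D\<close> in the second
        slot, so both sides are conjugated.\<close>
      using D_cinner[OF nd(2), of y] by (metis cinner_commute)
    also have "\<dots> = 0"
      using y nd(3) by (rule ocomplD')
    finally show "cinner (restrict T M x) (R y) = cinner x 0"
      using x by simp
  qed (use M' in auto)

  \<comment> \<open>The kernel of \<open>I - Q*Q\<close>\<close>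
  have E_iff: "y \<in> E \<longleftrightarrow> y \<in> ocompl M \<and> y \<in> D \<and> R y = 0" for y
  proof -
    have "norm (Q y) = norm y \<longleftrightarrow> norm (T y) = norm y \<and> R y = 0" if y: "y \<in> ocompl M"
    proof
      assume eq: "norm (Q y) = norm y"
      \<comment> \<open>Once \<open>Q y\<close> has the full norm of \<open>y\<close>, the bound
        \<open>norm (T y) \<le> norm y\<close> leaves nothing for \<open>R y\<close> in
        \<open>norm_T\<close>.\<close>
      then have "(norm (R y))\<^sup>2 \<le> 0"
        using norm_T[OF y] power_mono[OF T_le[of y], of 2] by simp
      then show "norm (T y) = norm y \<and> R y = 0"
        using eq T_RQ[OF y] by simp
    qed (use T_RQ[OF y] in auto)
    then show ?thesis
      by (auto simp: E_def defect_null_iff_norm[OF closed_csubspace_ocompl Q] D_iff)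
  qed
  have ME: "orthogonal_sets M E"
    by (auto simp: orthogonal_sets_def E_iff intro: ocomplD')

  \<comment> \<open>Equality of the two orthogonal sums\<close>
  have iff: "N \<^bold>\<oplus> D = M \<^bold>\<oplus> E \<longleftrightarrow> D \<inter> ocompl M \<subseteq> null_space (ocompl M) R"
  proof
    assume eq: "N \<^bold>\<oplus> D = M \<^bold>\<oplus> E"
    show "D \<inter> ocompl M \<subseteq> null_space (ocompl M) R"
    proof
      fix x assume x: "x \<in> D \<inter> ocompl M"
      then have "0 + x \<in> N \<^bold>\<oplus> D"
        using closed_csubspaceD(3)[OF N] by (intro subspace_sumI) auto
      then obtain m q where mq: "m \<in> M" "q \<in> E" "x = m + q"
        unfolding eq by (auto elim: subspace_sumE)
      \<comment> \<open>\<open>E\<close> lies in the complement of \<open>M\<close>, so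
        \<open>m = x - q\<close> lies there as well as in \<open>M\<close>.\<close>
      then have "x - q \<in> ocompl M"
        using x E_iff by (intro closed_csubspaceD(5)[OF closed_csubspace_ocompl]) auto
      then have "m = 0"
        using mq ocompl_disjoint by simp
      then show "x \<in> null_space (ocompl M) R"
        using mq E_iff by (simp add: null_space_def)
    qed
  next
    assume sub: "D \<inter> ocompl M \<subseteq> null_space (ocompl M) R"
    show "N \<^bold>\<oplus> D = M \<^bold>\<oplus> E"
    proof (intro subset_antisym subsetI)
      fix x assume "x \<in> M \<^bold>\<oplus> E"
      then obtain m q where mq: "m \<in> M" "q \<in> E" "x = m + q"
        by (rule subspace_sumE)
      have "0 + q \<in> N \<^bold>\<oplus> D"
        using mq closed_csubspaceD(3)[OF N] E_iff by (intro subspace_sumI) auto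
      then show "x \<in> N \<^bold>\<oplus> D"
        using mq M_sub closed_csubspaceD(4)[OF sum] by auto
    next
      fix x assume "x \<in> N \<^bold>\<oplus> D"
      then obtain n d where nd: "n \<in> N" "d \<in> D" "x = n + d"
        by (rule subspace_sumE)
      \<comment> \<open>Splitting \<open>d\<close> along \<open>M\<close> puts \<open>n + m\<close>
        into \<open>M\<close>; the point is that \<open>d - m\<close> remains in \<open>D\<close>,
        where the assumption applies.\<close>
      define m where "m = proj_on M d"
      have m: "m \<in> M" "d - m \<in> ocompl M"
        using M by (simp_all add: m_def proj_on_in diff_proj_on_in)
      \<comment> \<open>The kernel component \<open>n'\<close> of \<open>m\<close> vanishes: it is
        orthogonal to \<open>e\<close>, to \<open>d\<close> and to \<open>d - m\<close>, hence to
        \<open>m\<close> and so to itself.\<close>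
      have "m \<in> D"
      proof -
        obtain n' e where ne: "n' \<in> N" "e \<in> D" "m = n' + e"
          using M_decomp[OF m(1)] by blast
        have "cinner n' (d - m) = 0"
          using m(2) subsetD[OF N_sub ne(1)] by (rule ocomplD')
        moreover have "cinner n' d = 0" "cinner n' e = 0"
          using ND ne nd by (auto simp: orthogonal_sets_def)
        ultimately have "n' = 0"
          using ne by (simp add: cinner_diff_right cinner_add_right)
        with ne show ?thesis
          by simp
      qed
      then have "d - m \<in> D \<inter> ocompl M"
        using m nd closed_csubspaceD(5)[OF D] by blast
      then have "d - m \<in> E"
        using sub by (auto simp: E_iff null_space_def)
      moreover have "n + m \<in> M"
        using nd m N_sub M' by auto
      ultimately have "(n + m) + (d - m) \<in> M \<^bold>\<oplus> E"
        by (rule subspace_sumI[rotated])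
      then show "x \<in> M \<^bold>\<oplus> E"
        by (simp add: nd)
    qed
  qed
  have E_sub: "E \<subseteq> D"
    using E_iff by auto
  show ?thesis
    using pi_M max ND N_sub M_sub block W(2) R adj_WR Q E_sub ME iff
    unfolding Let_def N_def[symmetric] D_def[symmetric]
    by (intro exI[of _ M]) (simp add: R_def[symmetric] Q_def[symmetric] E_def[symmetric])
qed

end
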